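(* Let $R$ be a non-commutative associative ring with identity, let $G$ be an arbitrary group, and let $RG$ be the group ring of $G$ over $R$. Then $RG$ is Jordan nilpotent of index $4$ if and only if one of the following conditions holds: \begin{enumerate} \item[1)] $G$ is abelian, and $R$ is Jordan nilpotent of index $4$ with $\mathrm{Char}(R)=2$ or $4$ or $8$; \item[2)] $\mathrm{Char}(R)=4$, $2(R\circ R)=0$, $(R\circ R)\circ R=0$, $(R\circ R)(R\circ R)=0$, and $G'\simeq C_2$; \item[3)] $\mathrm{Char}(R)=2$, $(R\circ R)\circ R=0$, $(R\circ R)(R\circ R)=0$, and $G'\simeq C_2$. \end{enumerate}
   Context: "Non-commutative ring" means a ring that is not commutative. For an associative ring $S$, the Jordan (circle) product is $\alpha\circ\beta=\alpha\beta+\beta\alpha$ for $\alpha,\beta\in S$. The ring $S$ is called Jordan nilpotent of index $n$ if $(\dots((\alpha_1\circ\alpha_2)\circ\alpha_3)\dots)\circ\alpha_n=0$ for all $\alpha_1,\dots,\alpha_n\in S$ (no minimality of $n$ is required); in particular, index $4$ means $((\alpha_1\circ\alpha_2)\circ\alpha_3)\circ\alpha_4=0$ for all $\alpha_1,\alpha_2,\alpha_3,\alpha_4\in S$. The conditions on $R$ are elementwise: $2(R\circ R)=0$ means $2(\alpha\circ\beta)=0$ for all $\alpha,\beta\in R$; $(R\circ R)\circ R=0$ means $(\alpha\circ\beta)\circ\gamma=0$ for all $\alpha,\beta,\gamma\in R$; $(R\circ R)(R\circ R)=0$ means $(\alpha\circ\beta)(\gamma\circ\delta)=0$ for all $\alpha,\beta,\gamma,\delta\in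 R$. $\mathrm{Char}(R)$ is the characteristic of $R$, $G'$ is the derived (commutator) subgroup of $G$, and $C_2$ is the cyclic group of order $2$. *)

theory Defs
  imports
    "HOL-Library.Poly_Mapping"
    "HOL-Algebra.Elementary_Groups"
    "HOL-Computational_Algebra.Computational_Algebra"
begin

text \<open>
  The group ring of \<open>G\<close> over \<open>R\<close> is the type \<^typ>\<open>'g \<Rightarrow>\<^sub>0 'r\<close> of finitely supported functions,
  whose multiplication is the convolution product
  \<open>(f * f') k = (\<Sum>(g, h) | k = g + h. f g * f' h)\<close>.  Accordingly, the group is written
  additively, as an instance of \<^class>\<open>group_add\<close>; this class does not include commutativity
  (that is \<^class>\<open>ab_group_add\<close>).
\<close>

definition jordan_prod :: "'a::ring \<Rightarrow> 'a \<Rightarrow> 'a"  (infixl "\<circ>\<^sub>J" 70)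
  where "a \<circ>\<^sub>J b = a * b + b * a"

text \<open>
  The index counts all factors of the left-normed product, including the initial one, and need
  not be minimal.
\<close>

definition jordan_nilpotent :: "'a::ring itself \<Rightarrow> nat \<Rightarrow> bool"
  where "jordan_nilpotent _ n \<longleftrightarrow>
    (\<forall>(a::'a) as. length (a # as) = n \<longrightarrow> foldl (\<circ>\<^sub>J) a as = 0)"

lemma jordan_nilpotent_4:
  "jordan_nilpotent TYPE('a::ring) 4 \<longleftrightarrow>
    (\<forall>a b c d :: 'a. ((a \<circ>\<^sub>J b) \<circ>\<^sub>J c) \<circ>\<^sub>J d = 0)"
proof
  assume *: "jordan_nilpotent TYPE('a) 4"
  show "\<forall>a b c d :: 'a. ((a \<circ>\<^sub>J b) \<circ>\<^sub>J c) \<circ>\<^sub>J d = 0"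
  proof (intro allI)
    fix a b c d :: 'a
    have "foldl (\<circ>\<^sub>J) a [b, c, d] = 0"
      using *[unfolded jordan_nilpotent_def, rule_format, of a "[b, c, d]"] by (simp add: numeral_eq_Suc)
    then show "((a \<circ>\<^sub>J b) \<circ>\<^sub>J c) \<circ>\<^sub>J d = 0"
      by simp
  qed
qed (auto simp: jordan_nilpotent_def numeral_eq_Suc length_Suc_conv)

text \<open>
  The group underlying a type of class \<^class>\<open>group_add\<close>, as a structure, so that subgroups
  and isomorphisms can be spoken of.
\<close>

definition group_of_type :: "'g::group_add itself \<Rightarrow> 'g monoid"
  where "group_of_type _ = \<lparr>carrier = UNIV, monoid.mult = (+), one = 0\<rparr>"

lemma group_group_of_type: "Group.group (group_of_type TYPE('g::group_add))"
proof (rule groupI)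
  fix x :: 'g assume "x \<in> carrier (group_of_type TYPE('g))"
  show "\<exists>y\<in>carrier (group_of_type TYPE('g)).
      y \<otimes>\<^bsub>group_of_type TYPE('g)\<^esub> x = \<one>\<^bsub>group_of_type TYPE('g)\<^esub>"
    by (rule bexI[of _ "- x"]) (simp_all add: group_of_type_def)
qed (simp_all add: group_of_type_def add.assoc)

definition derived_subgroup :: "('a, 'b) monoid_scheme \<Rightarrow> ('a, 'b) monoid_scheme"
  where "derived_subgroup G = G\<lparr>carrier := derived G (carrier G)\<rparr>"

end

theory Submission
  imports Defs
begin

text \<open>
  Both directions compare coefficients in Jordan products of monomials, the elements \<open>a g\<close> of the
  group ring with \<open>a\<close> in \<open>R\<close> and \<open>g\<close> in \<open>G\<close>, for which
  \<open>a g \<circ> b h = ab gh + ba hg\<close>.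

  Necessity. Since \<open>R\<close> lies in \<open>RG\<close>, it inherits the index, and
  \<open>((1 \<circ> 1) \<circ> 1) \<circ> 1 = 8\<close> bounds the characteristic. Suppose that \<open>g\<close> and \<open>h\<close> do not commute.
  The product \<open>((a g \<circ> h) \<circ> b) \<circ> c\<close> equals \<open>((a \<circ> b) \<circ> c) (gh + hg)\<close>, so \<open>R\<close> already has index 3
  (\<open>jordan_nilpotent_3_if_noncommutative_group\<close>); taking units yields \<open>4 = 0\<close> and
  \<open>2 (R \<circ> R) = 0\<close>. The main trick is that for a ring commutator \<open>z = ba - ab\<close> the monomial \<open>z x\<close> is
  a difference of Jordan products, \<open>a x \<circ> b - ab x \<circ> 1\<close>; hence the products of \<open>z x\<close> with only
  two further elements vanish (\<open>single_commutator_jordan\<close>). With \<open>z \<noteq> 0\<close> fixed, the coefficients of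
  \<open>(z x \<circ> k) \<circ> l\<close> force \<open>xk\<close> to be conjugated by \<open>l\<close> into \<open>xk\<close> or \<open>kx\<close>: all conjugacy classes
  of \<open>G\<close> have at most two elements, which is possible only if \<open>G'\<close> has order at most two
  (\<open>conj_class_le_two_imp_commutation_element\<close>). The coefficients of
  \<open>(z g \<circ> c h) \<circ> d (gh)\<^sup>-\<^sup>1\<close> give \<open>z (c \<circ> d) = 0\<close>, and then \<open>(R \<circ> R)(R \<circ> R) = 0\<close>, because
  \<open>a \<circ> b = z + 2ab\<close>.

  Sufficiency. By multilinearity only monomials matter. For abelian \<open>G\<close> the Jordan products are
  taken in the coefficients alone. For \<open>G' = {1, u}\<close>, the first product \<open>a g \<circ> b h\<close> is a monomial
  with coefficient in \<open>R \<circ> R\<close>, up to a term divisible by \<open>1 - u\<close>. After the second product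
  everything has the form \<open>t (1 - u) y\<close> with \<open>t\<close> central and \<open>2 t = 0\<close>, and the third
  product annihilates such elements
  (\<open>central_twisted_diff_jordan_prod_single\<close>).
\<close>

section \<open>Groups with conjugacy classes of at most two elements\<close>

definition conjugate :: "'g::group_add \<Rightarrow> 'g \<Rightarrow> 'g"
  where "conjugate x y = - x + (y + x)"

lemma conjugate_conjugate: "conjugate x (conjugate y g) = conjugate (y + x) g"
  by (simp add: conjugate_def minus_add add.assoc del: add_uminus_conv_diff)

lemma conjugate_inject [simp]: "conjugate x y = conjugate x z \<longleftrightarrow> y = z"
  by (simp add: conjugate_def)

lemma conjugate_add: "conjugate x (y + z) = conjugate x y + conjugate x z"
  by (simp add: conjugate_def add.assoc)

lemma conjugate_minus: "conjugate x (- y) = - conjugate x y"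
  by (simp add: conjugate_def minus_add add.assoc del: add_uminus_conv_diff)

lemma conjugate_eq_self_iff: "conjugate x y = y \<longleftrightarrow> y + x = x + y"
  unfolding conjugate_def by (metis add_minus_cancel minus_add_cancel)

definition commutator :: "'g::group_add \<Rightarrow> 'g \<Rightarrow> 'g"
  where "commutator y x = - y + conjugate x y"

lemma conjugate_conv_commutator: "conjugate x y = y + commutator y x"
  by (simp add: commutator_def)

lemma commutator_eq_0_iff: "commutator y x = 0 \<longleftrightarrow> y + x = x + y"
  unfolding conjugate_eq_self_iff[symmetric] commutator_def
  by (metis add_minus_cancel add.right_neutral left_minus)

lemma commutator_swap: "commutator x y = - commutator y x"
  by (simp add: commutator_def conjugate_def minus_add add.assoc del: add_uminus_conv_diff)

lemma add_swap_commutator: "g + h = h + (g + commutator g h)"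
  by (simp add: commutator_def conjugate_def add.assoc)

text \<open>
  Let \<open>u = [y, x]\<close>, so that the class of \<open>y\<close> is \<open>{y, y + u}\<close>. An inner automorphism either fixes
  both elements or exchanges them. Conjugation by \<open>y\<close> fixes both, so \<open>y\<close>
  commutes with \<open>u\<close>; by symmetry so does \<open>x\<close>. Conjugation by \<open>x\<close> exchanges them, so
  \<open>y = (y + u) + u\<close>. Since \<open>u\<close> is its own inverse, an arbitrary inner automorphism fixes \<open>u\<close> in
  either case.
\<close>

lemma conj_class_le_two_imp_central_commutator:
  fixes x y :: "'g::group_add"
  assumes two: "\<And>y l x :: 'g. conjugate l y = y \<or> conjugate x y = y \<or> conjugate l y = conjugate x y"
    and ne: "y + x \<noteq> x + y"
  shows "commutator y x + commutator y x = 0"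
    and "conjugate l (commutator y x) = commutator y x"
    and "commutator y l = 0 \<or> commutator y l = commutator y x"
proof -
  let ?u = "commutator y x"
  have cne: "conjugate x y \<noteq> y"
    using ne by (simp add: conjugate_eq_self_iff)
  have u2: "?u + ?u = 0" if "conjugate x ?u = ?u"
  proof -
    have "conjugate (x + x) y \<noteq> conjugate x y"
      unfolding conjugate_conjugate[symmetric] using cne by simp
    then have "conjugate (x + x) y = y"
      using two[of "x + x" y x] cne by auto
    then have "conjugate x (y + ?u) = y"
      by (simp add: conjugate_conjugate flip: conjugate_conv_commutator)
    then show ?thesis
      using that by (simp add: conjugate_add conjugate_conv_commutator[of x y] add.assoc)
        (metis add_left_cancel add.right_neutral)
  qed
  have self: "conjugate b (commutator b a) = commutator b a" if "b + a \<noteq> a + b" for a b :: 'g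
  proof -
    have "conjugate (a + b) b \<noteq> b"
      using that by (metis add.assoc add_left_cancel add_right_cancel conjugate_eq_self_iff)
    then have "conjugate (a + b) b = conjugate a b"
      using two[of "a + b" b a] that by (auto simp: conjugate_eq_self_iff)
    then have "conjugate b (b + commutator b a) = b + commutator b a"
      by (simp add: conjugate_conjugate flip: conjugate_conv_commutator)
    then show ?thesis
      by (simp add: conjugate_add conjugate_eq_self_iff[THEN iffD2, of b b])
  qed
  have "conjugate x (commutator x y) = commutator x y"
    using self[of x y] ne by metis
  then have "conjugate x ?u = ?u"
    by (simp add: commutator_swap[of x y] conjugate_minus)
  with u2 show *: "?u + ?u = 0" by blast
  show l: "commutator y l = 0 \<or> commutator y l = ?u" for l
    using two[of l y x] cne by (metis conjugate_conv_commutator add_left_cancel add.right_neutral)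
  show "conjugate l ?u = ?u"
  proof (cases "conjugate l y = y")
    case True
    have "conjugate (x + l) y \<noteq> y"
      using True cne by (metis conjugate_conjugate conjugate_inject)
    then have "conjugate l (conjugate x y) = conjugate x y"
      using two[of "x + l" y x] cne by (auto simp: conjugate_conjugate)
    then show ?thesis
      using True by (simp add: conjugate_conv_commutator[of x y] conjugate_add)
  next
    case False
    then have ly: "conjugate l y = y + ?u"
      using l[of l] by (auto simp: conjugate_conv_commutator)
    have "conjugate l (conjugate x y) \<noteq> conjugate x y"
      using cne ly by (metis conjugate_conv_commutator conjugate_inject)
    then have "conjugate l (conjugate x y) = y"
      using two[of "x + l" y x] cne by (auto simp: conjugate_conjugate)
    then have "y + (?u + conjugate l ?u) = y + 0"
      using ly by (simp only: conjugate_conv_commutator[of x y] conjugate_add add.assoc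
          add.right_neutral)
    then have "?u + conjugate l ?u = ?u + ?u"
      unfolding add_left_cancel * .
    then show ?thesis by simp
  qed
qed

text \<open>
  The elements \<open>u\<close> of exponent two in the centre with \<open>G' \<subseteq> {0, u}\<close>. Abelian groups are included
  (with \<open>u = 0\<close>), so that only the distinction whether \<open>G\<close> is abelian is left to the derived
  subgroup.
\<close>

definition commutation_element :: "'g::group_add \<Rightarrow> bool"
  where "commutation_element u \<longleftrightarrow> u + u = 0 \<and> (\<forall>g. u + g = g + u)
    \<and> (\<forall>g h. g + h = h + g \<or> g + h = u + (h + g))"

text \<open>
  All nontrivial commutators coincide. Two of them with a common entry do, because a class has no
  third element; two commutators \<open>[y, x]\<close> and \<open>[h, g]\<close> are linked by an element \<open>a\<close> that commutes
  with neither \<open>y\<close> nor \<open>h\<close>.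
\<close>

lemma conj_class_le_two_imp_commutation_element:
  assumes two: "\<And>y l x :: 'g::group_add.
      conjugate l y = y \<or> conjugate x y = y \<or> conjugate l y = conjugate x y"
  shows "\<exists>u :: 'g. commutation_element u"
proof (cases "\<exists>x y :: 'g. y + x \<noteq> x + y")
  case False
  then show ?thesis
    by (intro exI[of _ 0]) (auto simp: commutation_element_def)
next
  case True
  then obtain x y :: 'g where ne: "y + x \<noteq> x + y" by blast
  let ?u = "commutator y x"
  note cc = conj_class_le_two_imp_central_commutator[OF two]
  have u2: "?u + ?u = 0" using cc(1)[OF ne] .
  have central: "?u + g = g + ?u" for g
    using cc(2)[OF ne, of g] by (simp add: conjugate_eq_self_iff)
  have sym: "commutator a b = commutator b a" if "b + a \<noteq> a + b" for a b :: 'g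
    using cc(1)[OF that] by (simp add: commutator_swap[of a b] minus_unique)
  have uniq: "commutator h g = ?u" if hg: "h + g \<noteq> g + h" for g h
  proof -
    have shared: "commutator b a = commutator b' a" if "b + a \<noteq> a + b" "b' + a \<noteq> a + b'" for a b b' :: 'g
      using that sym cc(3) commutator_eq_0_iff by metis
    \<comment> \<open>A group is not the union of two proper subgroups, here the centralisers of \<open>y\<close> and \<open>h\<close>: if
      neither \<open>x\<close> nor \<open>g\<close> avoids both, then \<open>x + g\<close> does.\<close>
    obtain a where a: "y + a \<noteq> a + y" "h + a \<noteq> a + h"
    proof -
      consider "h + x \<noteq> x + h" | "y + g \<noteq> g + y" | "h + x = x + h" "y + g = g + y" by blast
      then show thesis
      proof cases
        case 3
        have "y + (x + g) \<noteq> (x + g) + y"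
          using 3 ne by (metis add.assoc add_right_cancel)
        moreover have "h + (x + g) \<noteq> (x + g) + h"
          using 3 hg by (metis add.assoc add_left_cancel)
        ultimately show thesis by (rule that)
      qed (use that ne hg in blast)+
    qed
    have "commutator y a = ?u"
      using cc(3)[OF ne, of a] a(1) by (simp add: commutator_eq_0_iff)
    moreover have "commutator h a = commutator h g"
      using cc(3)[OF hg, of a] a(2) by (simp add: commutator_eq_0_iff)
    ultimately show ?thesis
      using shared[OF a] by simp
  qed
  have "g + h = h + g \<or> g + h = ?u + (h + g)" for g h
    using uniq[of g h] add_swap_commutator[of g h] central by (metis add.assoc)
  with u2 central show ?thesis
    unfolding commutation_element_def by blast
qed

section \<open>Derived subgroups of order two\<close>

lemma comm_group_of_type_iff:
  "comm_group (group_of_type TYPE('g::group_add)) \<longleftrightarrow> (\<forall>g h :: 'g. g + h = h + g)"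
proof
  assume "comm_group (group_of_type TYPE('g))"
  then interpret comm_group "group_of_type TYPE('g)" .
  show "\<forall>g h :: 'g. g + h = h + g"
    using m_comm by (simp add: group_of_type_def)
next
  assume "\<forall>g h :: 'g. g + h = h + g"
  then show "comm_group (group_of_type TYPE('g))"
    by (intro group.group_comm_groupI group_group_of_type) (auto simp: group_of_type_def)
qed

lemma inv_group_of_type: "inv\<^bsub>group_of_type TYPE('g::group_add)\<^esub> (g :: 'g) = - g"
  by (rule group.inv_equality[OF group_group_of_type]) (simp_all add: group_of_type_def)

lemma derived_set_group_of_type:
  "derived_set (group_of_type TYPE('g::group_add)) UNIV = {g + h + - g + - h |g h :: 'g. True}"
proof -
  have "derived_set (group_of_type TYPE('g)) UNIV =
    (\<Union>g. \<Union>h. {g + h + inv\<^bsub>group_of_type TYPE('g)\<^esub> g + inv\<^bsub>group_of_type TYPE('g)\<^esub> h})"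
    by (simp add: group_of_type_def)
  then show ?thesis
    by (auto simp: inv_group_of_type)
qed

lemma add_eq_commutator_add: "g + h = (g + h + - g + - h) + (h + (g :: 'g::group_add))"
  by (simp add: add.assoc del: add_uminus_conv_diff)

text \<open>
  A normal subgroup of order two is central, since conjugation fixes its only nonzero element.
\<close>

lemma derived_subgroup_iso_C2_imp_commutation_element:
  assumes "derived_subgroup (group_of_type TYPE('g::group_add)) \<cong> integer_mod_group 2"
  shows "\<exists>u :: 'g. commutation_element u"
proof -
  interpret group "group_of_type TYPE('g)" by (rule group_group_of_type)
  let ?D = "derived (group_of_type TYPE('g)) UNIV"
  have carr [simp]: "carrier (group_of_type TYPE('g)) = UNIV"
    and mlt [simp]: "(x \<otimes>\<^bsub>group_of_type TYPE('g)\<^esub> y) = x + y"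
    and one [simp]: "\<one>\<^bsub>group_of_type TYPE('g)\<^esub> = 0" for x y
    by (simp_all add: group_of_type_def)
  have "?D \<lhd> group_of_type TYPE('g)"
    using derived_self_is_normal by simp
  then interpret D: normal ?D "group_of_type TYPE('g)" .
  from assms obtain \<phi> where "bij_betw \<phi> ?D {0..<2::int}"
    by (auto simp: is_iso_def iso_def derived_subgroup_def carrier_integer_mod_group)
  then have "card ?D = 2"
    by (simp add: bij_betw_same_card)
  moreover have "0 \<in> ?D" using D.one_closed by simp
  ultimately obtain u where u: "?D = {0, u}" "u \<noteq> 0"
    by (metis card_2_iff doubleton_eq_iff insertE singletonD)
  have "u + u \<in> ?D"
    using D.m_closed[of u u] u by simp
  then have "u + u = 0" using u by (metis add_left_cancel add.right_neutral insertE singletonD)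
  moreover have "u + g = g + u" for g
  proof -
    have "g + u + - g \<in> ?D"
      using D.inv_op_closed2[of g u] u by (simp add: inv_group_of_type)
    moreover have "g + u + - g \<noteq> 0"
      using u(2) by (metis add.right_neutral add_left_cancel add_minus_cancel add.assoc
          add_right_cancel right_minus)
    ultimately have "g + u + - g = u" using u by auto
    then show ?thesis by (metis add.assoc add.right_neutral left_minus)
  qed
  moreover have "g + h = h + g \<or> g + h = u + (h + g)" for g h
  proof -
    have "g + h + - g + - h \<in> derived_set (group_of_type TYPE('g)) UNIV"
      unfolding derived_set_group_of_type by blast
    then have "g + h + - g + - h \<in> ?D"
      unfolding derived_def by (rule generate.incl)
    then have "g + h + - g + - h = 0 \<or> g + h + - g + - h = u"
      using u by auto
    then show ?thesis
      by (metis add_eq_commutator_add add.left_neutral)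
  qed
  ultimately show ?thesis
    unfolding commutation_element_def by blast
qed

lemma commutation_element_imp_derived_subgroup_iso_C2:
  fixes u :: "'g::group_add"
  assumes u: "commutation_element u" and ne: "g + h \<noteq> h + (g :: 'g)"
  shows "derived_subgroup (group_of_type TYPE('g)) \<cong> integer_mod_group 2"
proof -
  interpret group "group_of_type TYPE('g)" by (rule group_group_of_type)
  have carr [simp]: "carrier (group_of_type TYPE('g)) = UNIV"
    and mlt [simp]: "(x \<otimes>\<^bsub>group_of_type TYPE('g)\<^esub> y) = x + y"
    and one [simp]: "\<one>\<^bsub>group_of_type TYPE('g)\<^esub> = 0" for x y
    by (simp_all add: group_of_type_def)
  have u2: "u + u = 0" and comm: "a + b = b + a \<or> a + b = u + (b + a)" for a b :: 'g
    using u unfolding commutation_element_def by blast+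
  have comm': "a + b + - a + - b \<in> {0, u}" for a b :: 'g
  proof -
    have "a + b + - a + - b = (a + b) + - (b + a)"
      by (simp add: minus_add add.assoc del: add_uminus_conv_diff)
    moreover have "(a + b) + - (b + a) = 0 \<or> (a + b) + - (b + a) = u"
      using comm[of a b] by (metis add.assoc right_minus add.right_neutral)
    ultimately show ?thesis by simp
  qed
  have u0: "u \<noteq> 0" using comm[of g h] ne by (metis add.left_neutral)
  have "subgroup {0, u} (group_of_type TYPE('g))"
    using u2 by unfold_locales (auto simp: inv_group_of_type minus_unique)
  then have "derived (group_of_type TYPE('g)) UNIV \<subseteq> {0, u}"
    unfolding derived_def derived_set_group_of_type using comm'
    by (intro generate_subgroup_incl) blast+
  moreover have "0 \<in> derived (group_of_type TYPE('g)) UNIV"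
    unfolding derived_def using generate.one[of "group_of_type TYPE('g)"] by simp
  moreover have "u \<in> derived (group_of_type TYPE('g)) UNIV"
  proof -
    have "g + h + - g + - h \<noteq> 0"
      using ne add_eq_commutator_add[of g h] by (metis add.left_neutral)
    then have "u = g + h + - g + - h" using comm'[of g h] by auto
    then show ?thesis
      unfolding derived_def derived_set_group_of_type by (auto intro!: generate.incl)
  qed
  ultimately have D: "derived (group_of_type TYPE('g)) UNIV = {0, u}" by blast
  let ?\<phi> = "\<lambda>x. if x = 0 then 0 else (1::int)"
  have "?\<phi> \<in> iso (derived_subgroup (group_of_type TYPE('g))) (integer_mod_group 2)"
    using u0 u2
    by (auto simp: iso_def hom_def derived_subgroup_def D bij_betw_def carrier_integer_mod_group
        inj_on_def)
  then show ?thesis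
    unfolding is_iso_def by blast
qed

section \<open>Jordan products\<close>

lemma jordan_prod_add_left: "(a + b) \<circ>\<^sub>J c = a \<circ>\<^sub>J c + b \<circ>\<^sub>J c"
  and jordan_prod_add_right: "c \<circ>\<^sub>J (a + b) = c \<circ>\<^sub>J a + c \<circ>\<^sub>J b"
  by (simp_all add: jordan_prod_def algebra_simps)

lemma jordan_prod_diff_left: "(a - b) \<circ>\<^sub>J c = a \<circ>\<^sub>J c - b \<circ>\<^sub>J c"
  by (simp add: jordan_prod_def algebra_simps)

lemma jordan_prod_zero [simp]: "0 \<circ>\<^sub>J a = 0" "a \<circ>\<^sub>J 0 = 0"
  by (simp_all add: jordan_prod_def)

lemma jordan_prod_one_right: "a \<circ>\<^sub>J 1 = a + (a :: 'a::ring_1)"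
  by (simp add: jordan_prod_def)

lemma single_jordan_prod_single:
  "Poly_Mapping.single g a \<circ>\<^sub>J Poly_Mapping.single h b
    = Poly_Mapping.single (g + h) (a * b) + Poly_Mapping.single (h + g) (b * a)"
  by (simp add: jordan_prod_def mult_single)

lemma additive_eq_zero_if_single:
  fixes f :: "('k \<Rightarrow>\<^sub>0 'v::ab_group_add) \<Rightarrow> 'b::ab_group_add"
  assumes add: "\<And>x y. f (x + y) = f x + f y"
    and single: "\<And>k v. f (Poly_Mapping.single k v) = 0"
  shows "f x = 0"
proof (induction x rule: update_induct)
  case const
  show ?case using single[of _ 0] by simp
next
  case (update g a b)
  have "Poly_Mapping.update a b g = Poly_Mapping.single a b + g"
    using update(1)
    by (intro poly_mapping_eqI)
      (auto simp: update.rep_eq lookup_add lookup_single when_def in_keys_iff)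
  then show ?case by (simp add: add single update)
qed

lemma jordan_nilpotent_4_if_single:
  assumes "\<And>(g :: 'g::group_add) h k l (a :: 'r::ring) b c d.
    ((Poly_Mapping.single g a \<circ>\<^sub>J Poly_Mapping.single h b) \<circ>\<^sub>J Poly_Mapping.single k c)
      \<circ>\<^sub>J Poly_Mapping.single l d = 0"
  shows "jordan_nilpotent TYPE('g \<Rightarrow>\<^sub>0 'r) 4"
proof -
  note J = jordan_prod_add_left jordan_prod_add_right
  have 1: "((\<alpha> \<circ>\<^sub>J Poly_Mapping.single h b) \<circ>\<^sub>J Poly_Mapping.single k c)
      \<circ>\<^sub>J Poly_Mapping.single l d = 0" for \<alpha> :: "'g \<Rightarrow>\<^sub>0 'r" and h b k c l d
    by (rule additive_eq_zero_if_single[of _ \<alpha>]) (simp_all add: J assms)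
  have 2: "((\<alpha> \<circ>\<^sub>J \<beta>) \<circ>\<^sub>J Poly_Mapping.single k c)
      \<circ>\<^sub>J Poly_Mapping.single l d = 0" for \<alpha> \<beta> :: "'g \<Rightarrow>\<^sub>0 'r" and k c l d
    by (rule additive_eq_zero_if_single[of _ \<beta>]) (simp_all add: J 1)
  have 3: "((\<alpha> \<circ>\<^sub>J \<beta>) \<circ>\<^sub>J \<gamma>) \<circ>\<^sub>J Poly_Mapping.single l d = 0"
    for \<alpha> \<beta> \<gamma> :: "'g \<Rightarrow>\<^sub>0 'r" and l d
    by (rule additive_eq_zero_if_single[of _ \<gamma>]) (simp_all add: J 2)
  have "((\<alpha> \<circ>\<^sub>J \<beta>) \<circ>\<^sub>J \<gamma>) \<circ>\<^sub>J \<delta> = 0" for \<alpha> \<beta> \<gamma> \<delta> :: "'g \<Rightarrow>\<^sub>0 'r"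
    by (rule additive_eq_zero_if_single[of _ \<delta>]) (simp_all add: J 3)
  then show ?thesis by (simp add: jordan_nilpotent_4)
qed

text \<open>
  In a ring of index 3 both Jordan products and ring commutators are of the following kind. For
  such \<open>t\<close> the Jordan product \<open>t \<circ> d\<close> and the commutator of \<open>t\<close> and \<open>d\<close> vanish simultaneously,
  as \<open>t\<close> and \<open>- t\<close> are the same element.
\<close>

definition central_two_torsion :: "'a::ring \<Rightarrow> bool"
  where "central_two_torsion t \<longleftrightarrow> t + t = 0 \<and> (\<forall>d. t * d = d * t)"

lemma central_two_torsion_jordan:
  assumes "central_two_torsion t"
  shows "t \<circ>\<^sub>J d = 0" "t * d = d * t" "t * d + t * d = 0"
  using assms
  by (simp_all add: central_two_torsion_def jordan_prod_def flip: distrib_left)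

lemma central_two_torsionI:
  fixes t :: "'a::ring"
  assumes t2: "t + t = 0" and J: "\<And>d. t \<circ>\<^sub>J d = 0"
  shows "central_two_torsion t"
proof -
  have "t * d = d * t" for d
  proof -
    have "t * d + t * d = 0" using t2 by (simp flip: distrib_right)
    moreover have "t * d + d * t = 0" using J by (simp add: jordan_prod_def)
    ultimately show ?thesis by (metis add_left_cancel)
  qed
  with t2 show ?thesis by (simp add: central_two_torsion_def)
qed

lemma central_two_torsion_if_jordan_nilpotent_3:
  fixes a b :: "'a::ring_1"
  assumes nil: "\<And>a b c :: 'a. (a \<circ>\<^sub>J b) \<circ>\<^sub>J c = 0"
  shows "central_two_torsion (a \<circ>\<^sub>J b)" "central_two_torsion (b * a - a * b)"
proof -
  have t2: "a \<circ>\<^sub>J b + a \<circ>\<^sub>J b = 0" for a b :: 'a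
    using nil[of a b 1] by (simp add: jordan_prod_one_right)
  show *: "central_two_torsion (a \<circ>\<^sub>J b)" for a b :: 'a
    using t2 nil by (intro central_two_torsionI)
  have four: "x + x + (x + x) = 0" for x :: 'a
    using nil[of x 1 1] by (simp add: jordan_prod_one_right)
  show "central_two_torsion (b * a - a * b)"
  proof (rule central_two_torsionI)
    \<comment> \<open>Commutators are differences of Jordan products, because \<open>(ab) \<circ> 1 = 2ab\<close>.\<close>
    have eq: "b * a - a * b = a \<circ>\<^sub>J b - ((a * b) \<circ>\<^sub>J 1)"
      by (simp add: jordan_prod_def)
    show "(b * a - a * b) \<circ>\<^sub>J d = 0" for d
      unfolding eq jordan_prod_diff_left nil by simp
    have "(b * a - a * b) + (b * a - a * b)
        = (a \<circ>\<^sub>J b + a \<circ>\<^sub>J b) - (a * b + a * b + (a * b + a * b))"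
      by (simp add: jordan_prod_def algebra_simps)
    then show "(b * a - a * b) + (b * a - a * b) = 0"
      by (simp only: t2 four diff_0_right)
  qed
qed

section \<open>Necessity\<close>

lemma jordan_nilpotent_coefficients:
  assumes "jordan_nilpotent TYPE('g::group_add \<Rightarrow>\<^sub>0 'r::ring_1) 4"
  shows "jordan_nilpotent TYPE('r) 4"
proof -
  have "((a \<circ>\<^sub>J b) \<circ>\<^sub>J c) \<circ>\<^sub>J d = 0" for a b c d :: 'r
  proof -
    have s: "Poly_Mapping.single (0::'g) a \<circ>\<^sub>J Poly_Mapping.single 0 b = Poly_Mapping.single 0 (a \<circ>\<^sub>J b)"
      for a b :: 'r
      by (simp add: single_jordan_prod_single jordan_prod_def[of a b] single_add)
    have "Poly_Mapping.single (0::'g) (((a \<circ>\<^sub>J b) \<circ>\<^sub>J c) \<circ>\<^sub>J d) = 0"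
      using assms unfolding jordan_nilpotent_4 s[symmetric] by blast
    then show ?thesis by (metis lookup_single_eq lookup_zero)
  qed
  then show ?thesis by (simp add: jordan_nilpotent_4)
qed

text \<open>
  The exponent is positive because \<open>0 \<noteq> 1\<close> in a type of class \<^class>\<open>ring_1\<close>.
\<close>

lemma CHAR_if_power_two_eq_zero:
  assumes "of_nat (2 ^ n) = (0 :: 'r::ring_1)"
  obtains i where "0 < i" "i \<le> n" "CHAR('r) = 2 ^ i"
proof -
  from assms have "CHAR('r) dvd 2 ^ n"
    by (simp only: of_nat_eq_0_iff_char_dvd)
  then obtain i where i: "i \<le> n" "CHAR('r) = 2 ^ i"
    using divides_primepow_nat[OF two_is_prime_nat] by blast
  moreover have "i \<noteq> 0" using i(2) CHAR_not_1[where 'a = 'r] by (cases i) auto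
  ultimately show thesis using that by blast
qed

lemma CHAR_if_jordan_nilpotent_4:
  assumes "jordan_nilpotent TYPE('r::ring_1) 4"
  shows "CHAR('r) \<in> {2, 4, 8}"
proof -
  have "((1 \<circ>\<^sub>J 1) \<circ>\<^sub>J 1) \<circ>\<^sub>J 1 = (0 :: 'r)"
    using assms by (simp add: jordan_nilpotent_4)
  then have "of_nat (2 ^ 3) = (0 :: 'r)"
    by (simp add: jordan_prod_one_right)
  then obtain i where "0 < i" "i \<le> 3" and i: "CHAR('r) = 2 ^ i"
    by (rule CHAR_if_power_two_eq_zero)
  then have "i = 1 \<or> i = 2 \<or> i = 3" by auto
  with i show ?thesis by auto
qed

lemma CHAR_if_jordan_nilpotent_3:
  assumes "((1 \<circ>\<^sub>J 1) \<circ>\<^sub>J 1) = (0 :: 'r::ring_1)"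
  shows "CHAR('r) = 2 \<or> CHAR('r) = 4"
proof -
  have "of_nat (2 ^ 2) = (0 :: 'r)"
    using assms by (simp add: jordan_prod_one_right)
  then obtain i where "0 < i" "i \<le> 2" and i: "CHAR('r) = 2 ^ i"
    by (rule CHAR_if_power_two_eq_zero)
  then have "i = 1 \<or> i = 2" by auto
  with i show ?thesis by auto
qed

text \<open>
  The identity \<open>(ba - ab) x = a x \<circ> b - ab x \<circ> 1\<close> hides one Jordan product inside a single monomial,
  so two more factors suffice.
\<close>

lemma single_commutator_jordan:
  assumes "jordan_nilpotent TYPE('g::group_add \<Rightarrow>\<^sub>0 'r::ring_1) 4"
  shows "(Poly_Mapping.single (x :: 'g) (b * a - a * (b :: 'r)) \<circ>\<^sub>J \<beta>) \<circ>\<^sub>J \<gamma> = 0"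
proof -
  have eq: "Poly_Mapping.single x (b * a - a * b) =
      Poly_Mapping.single x a \<circ>\<^sub>J Poly_Mapping.single 0 b
      - Poly_Mapping.single x (a * b) \<circ>\<^sub>J Poly_Mapping.single 0 1"
    by (simp add: single_jordan_prod_single single_diff del: single_one)
  show ?thesis
    using assms unfolding eq jordan_prod_diff_left by (simp add: jordan_nilpotent_4)
qed

text \<open>
  The product \<open>a g \<circ> 1 h = a (gh + hg)\<close> has an arbitrary coefficient \<open>a\<close> in front of \<open>gh + hg\<close>, which
  is nonzero with coefficient 1 at \<open>gh\<close> and commutes with \<open>R\<close>. The remaining two factors can be taken from
  \<open>R\<close>, where they act on \<open>a\<close> only.
\<close>

lemma jordan_nilpotent_3_if_noncommutative_group:
  fixes g h :: "'g::group_add" and a b c :: "'r::ring_1"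
  assumes N: "jordan_nilpotent TYPE('g \<Rightarrow>\<^sub>0 'r) 4" and ne: "g + h \<noteq> h + g"
  shows "(a \<circ>\<^sub>J b) \<circ>\<^sub>J c = 0"
proof -
  have "((Poly_Mapping.single g a \<circ>\<^sub>J Poly_Mapping.single h 1) \<circ>\<^sub>J Poly_Mapping.single 0 b)
      \<circ>\<^sub>J Poly_Mapping.single 0 c = 0"
    using N by (simp add: jordan_nilpotent_4)
  then have "Poly_Mapping.lookup (((Poly_Mapping.single g a \<circ>\<^sub>J Poly_Mapping.single h 1)
      \<circ>\<^sub>J Poly_Mapping.single 0 b) \<circ>\<^sub>J Poly_Mapping.single 0 c) (g + h) = 0"
    by simp
  then show ?thesis
    using ne by (simp add: single_jordan_prod_single jordan_prod_add_left lookup_add lookup_single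
        when_def) (simp add: jordan_prod_def algebra_simps)
qed

text \<open>
  Write \<open>z = ba - ab\<close>, which is central. Of the four group elements in \<open>(z g \<circ> c h) \<circ> d (gh)\<^sup>-\<^sup>1\<close> two are
  the identity and the others are not, since \<open>gh \<noteq> hg\<close>; the coefficient of the identity is
  \<open>z (c \<circ> d)\<close>.
\<close>

lemma commutator_times_jordan_prod:
  fixes g h :: "'g::group_add" and a b c d :: "'r::ring_1"
  assumes N: "jordan_nilpotent TYPE('g \<Rightarrow>\<^sub>0 'r) 4" and ne: "g + h \<noteq> h + g"
  shows "(b * a - a * b) * (c \<circ>\<^sub>J d) = 0"
proof -
  let ?z = "b * a - a * b"
  let ?l = "- (g + h)"
  have nil: "(a \<circ>\<^sub>J b) \<circ>\<^sub>J c = 0" for a b c :: 'r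
    using jordan_nilpotent_3_if_noncommutative_group[OF N ne] .
  have z: "central_two_torsion ?z"
    using central_two_torsion_if_jordan_nilpotent_3[OF nil] by blast
  have ne': "h + g + ?l \<noteq> 0" "?l + (h + g) \<noteq> 0"
    using ne by (metis add.assoc add.right_neutral left_minus add.left_neutral,
      metis add_minus_cancel add.right_neutral)
  have "Poly_Mapping.lookup ((Poly_Mapping.single g ?z \<circ>\<^sub>J Poly_Mapping.single h c)
      \<circ>\<^sub>J Poly_Mapping.single ?l d) 0 = 0"
    by (simp only: single_commutator_jordan[OF N] lookup_zero)
  then have "?z * c * d + d * (?z * c) = 0"
    unfolding single_jordan_prod_single jordan_prod_add_left lookup_add lookup_single when_def
    using ne' by (simp del: minus_add_distrib)
  moreover have "d * (?z * c) = ?z * (d * c)"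
    using central_two_torsion_jordan(2)[OF z, of d] by (simp flip: mult.assoc)
  ultimately show ?thesis
    by (simp add: jordan_prod_def distrib_left mult.assoc)
qed

lemma jordan_prod_times_jordan_prod:
  fixes g h :: "'g::group_add" and a b c d :: "'r::ring_1"
  assumes N: "jordan_nilpotent TYPE('g \<Rightarrow>\<^sub>0 'r) 4" and ne: "g + h \<noteq> h + g"
  shows "(a \<circ>\<^sub>J b) * (c \<circ>\<^sub>J d) = 0"
proof -
  have nil: "(a \<circ>\<^sub>J b) \<circ>\<^sub>J c = 0" for a b c :: 'r
    using jordan_nilpotent_3_if_noncommutative_group[OF N ne] .
  have "c \<circ>\<^sub>J d + c \<circ>\<^sub>J d = 0"
    using nil[of c d 1] by (simp add: jordan_prod_one_right)
  then have "a * b * (c \<circ>\<^sub>J d) + a * b * (c \<circ>\<^sub>J d) = 0"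
    by (simp flip: distrib_left)
  moreover have "(a \<circ>\<^sub>J b) * (c \<circ>\<^sub>J d) = (b * a - a * b) * (c \<circ>\<^sub>J d)
      + (a * b * (c \<circ>\<^sub>J d) + a * b * (c \<circ>\<^sub>J d))"
    by (simp add: jordan_prod_def[of a b] algebra_simps)
  ultimately show ?thesis
    by (simp add: commutator_times_jordan_prod[OF N ne])
qed

text \<open>
  Factor \<open>y = x + k\<close>, so that \<open>k + x\<close> is the conjugate of \<open>y\<close> by \<open>x\<close>. The product
  \<open>(z x \<circ> k) \<circ> l\<close> with \<open>z = ba - ab\<close> has the support elements \<open>xkl\<close>, \<open>kxl\<close>, \<open>lxk\<close>, \<open>lkx\<close>, each
  with coefficient \<open>z \<noteq> 0\<close>. As the product is zero, \<open>xkl\<close> must coincide with another one, and each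
  of the three coincidences is one of the alternatives.
\<close>

lemma conj_class_le_two_if_jordan_nilpotent_4:
  fixes x y l :: "'g::group_add"
  assumes N: "jordan_nilpotent TYPE('g \<Rightarrow>\<^sub>0 'r::ring_1) 4"
    and noncomm: "a * b \<noteq> b * (a :: 'r)"
  shows "conjugate l y = y \<or> conjugate x y = y \<or> conjugate l y = conjugate x y"
proof (rule ccontr)
  assume contra: "\<not> ?thesis"
  define k where "k = - x + y"
  have xk: "x + k = y" by (simp add: k_def)
  have kx: "k + x = conjugate x y" by (simp add: k_def conjugate_def add.assoc)
  let ?z = "b * a - a * b"
  have l: "l + y \<noteq> y + l"
    using contra by (metis conjugate_eq_self_iff)
  have l': "l + (k + x) \<noteq> y + l"
    using contra unfolding kx conjugate_def by (metis minus_add_cancel)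
  have "Poly_Mapping.lookup ((Poly_Mapping.single x ?z \<circ>\<^sub>J Poly_Mapping.single k 1)
      \<circ>\<^sub>J Poly_Mapping.single l 1) (y + l) = 0"
    by (simp only: single_commutator_jordan[OF N] lookup_zero)
  then have "?z = 0"
    unfolding single_jordan_prod_single jordan_prod_add_left lookup_add lookup_single when_def xk
    using l l' contra kx by simp
  with noncomm show False by simp
qed

section \<open>Sufficiency\<close>

text \<open>
  In multiplicative notation this is the element \<open>r (1 - u) y\<close> of the group ring. As \<open>u\<^sup>2 = 1\<close>, it
  changes its sign when \<open>y\<close> is replaced by \<open>uy\<close>.
\<close>

definition twisted_diff :: "'g::group_add \<Rightarrow> 'r::ring_1 \<Rightarrow> 'g \<Rightarrow> 'g \<Rightarrow>\<^sub>0 'r"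
  where "twisted_diff u r y = Poly_Mapping.single y r - Poly_Mapping.single (u + y) r"

lemma commutation_element_cases:
  assumes "commutation_element u"
  obtains "g + h = h + g" | "g + h = u + (h + g)" "h + g = u + (g + h)"
proof -
  have "u + (u + x) = x" for x
    using assms by (metis commutation_element_def add.assoc add.left_neutral)
  then show thesis
    using assms that unfolding commutation_element_def by metis
qed

lemma single_jordan_prod_single_cases:
  assumes "commutation_element u"
  shows "Poly_Mapping.single g a \<circ>\<^sub>J Poly_Mapping.single h b = Poly_Mapping.single (h + g) (a \<circ>\<^sub>J b)
    \<or> Poly_Mapping.single g a \<circ>\<^sub>J Poly_Mapping.single h b
      = Poly_Mapping.single (h + g) (a \<circ>\<^sub>J b) - twisted_diff u (a * b) (h + g)"
  using assms
proof (cases rule: commutation_element_cases[where g = g and h = h])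
  case 1
  then show ?thesis
    by (simp add: single_jordan_prod_single jordan_prod_def[of a b] single_add)
next
  case 2
  show ?thesis
    unfolding single_jordan_prod_single jordan_prod_def[of a b] twisted_diff_def 2(1)
    by (simp add: single_add)
qed

text \<open>
  As \<open>s \<circ> c = 0\<close>, only the \<open>1 - u\<close> part of the product is left.
\<close>

lemma central_single_jordan_prod_single:
  assumes u: "commutation_element u" and s: "central_two_torsion s"
  shows "Poly_Mapping.single x s \<circ>\<^sub>J Poly_Mapping.single k c = 0
    \<or> Poly_Mapping.single x s \<circ>\<^sub>J Poly_Mapping.single k c = - twisted_diff u (s * c) (k + x)"
proof -
  have "c * s = s * c" and eq: "c \<circ>\<^sub>J s = 0" "s \<circ>\<^sub>J c = 0"
    using central_two_torsion_jordan[OF s, of c] by (simp_all add: jordan_prod_def add.commute)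
  then show ?thesis
    using single_jordan_prod_single_cases[OF u, of x s k c] by auto
qed

text \<open>
  Interchanging noncommuting group elements costs a sign on multiples of \<open>1 - u\<close>, which turns the
  Jordan product of the coefficients into a commutator.
\<close>

lemma twisted_diff_jordan_prod_single:
  fixes c :: "'r::ring_1"
  assumes u: "commutation_element u"
  shows "twisted_diff u r y \<circ>\<^sub>J Poly_Mapping.single k c = twisted_diff u (r \<circ>\<^sub>J c) (k + y)
    \<or> twisted_diff u r y \<circ>\<^sub>J Poly_Mapping.single k c = twisted_diff u (c * r - r * c) (k + y)"
proof -
  have uc: "k + (u + y) = u + (k + y)" and uu: "u + (u + x) = x" for x
    using u unfolding commutation_element_def by (metis add.assoc, metis add.assoc add.left_neutral)
  have eq: "twisted_diff u r y \<circ>\<^sub>J Poly_Mapping.single k c =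
      Poly_Mapping.single (y + k) (r * c) + Poly_Mapping.single (k + y) (c * r)
      - Poly_Mapping.single (u + (y + k)) (r * c) - Poly_Mapping.single (u + (k + y)) (c * r)"
    unfolding twisted_diff_def jordan_prod_diff_left single_jordan_prod_single uc
    by (simp add: add.assoc)
  from u show ?thesis
  proof (cases rule: commutation_element_cases[where g = y and h = k])
    case 1
    then show ?thesis
      unfolding eq by (simp add: twisted_diff_def jordan_prod_def single_add)
  next
    case 2
    show ?thesis
      unfolding eq 2(1) uu by (simp add: twisted_diff_def single_diff)
  qed
qed

lemma central_twisted_diff_jordan_prod_single:
  assumes "commutation_element u" "central_two_torsion t"
  shows "twisted_diff u t y \<circ>\<^sub>J Poly_Mapping.single l d = 0"
  using twisted_diff_jordan_prod_single[OF assms(1), of t y l d]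
    central_two_torsion_jordan[OF assms(2), of d]
  by (simp add: twisted_diff_def)

text \<open>
  The coefficients that occur in front of \<open>1 - u\<close> after two products are \<open>(a \<circ> b) c\<close>, \<open>ab \<circ> c\<close> and the
  commutator of \<open>c\<close> and \<open>ab\<close>. The last two are central by index 3; the first is central because
  \<open>(a \<circ> b) c \<circ> e = (a \<circ> b)(c \<circ> e) = 0\<close>, and this is where \<open>(R \<circ> R)(R \<circ> R) = 0\<close> enters.
\<close>

lemma jordan_nilpotent_4_if_commutation_element:
  fixes u :: "'g::group_add"
  assumes u: "commutation_element u"
    and nil: "\<And>a b c :: 'r::ring_1. (a \<circ>\<^sub>J b) \<circ>\<^sub>J c = 0"
    and sq: "\<And>a b c d :: 'r. (a \<circ>\<^sub>J b) * (c \<circ>\<^sub>J d) = 0"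
  shows "jordan_nilpotent TYPE('g \<Rightarrow>\<^sub>0 'r) 4"
proof (rule jordan_nilpotent_4_if_single)
  fix g h k l :: 'g and a b c d :: 'r
  note central = central_two_torsion_if_jordan_nilpotent_3[OF nil]
  have sc: "central_two_torsion ((a \<circ>\<^sub>J b) * c)"
  proof (rule central_two_torsionI)
    show "(a \<circ>\<^sub>J b) * c + (a \<circ>\<^sub>J b) * c = 0"
      using central_two_torsion_jordan(3)[OF central(1)] .
    have "e * ((a \<circ>\<^sub>J b) * c) = (a \<circ>\<^sub>J b) * (e * c)" for e
      using central_two_torsion_jordan(2)[OF central(1), of a b e] by (simp flip: mult.assoc)
    then have "((a \<circ>\<^sub>J b) * c) \<circ>\<^sub>J e = (a \<circ>\<^sub>J b) * (c \<circ>\<^sub>J e)" for e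
      by (simp add: jordan_prod_def[of _ e] distrib_left mult.assoc)
    then show "((a \<circ>\<^sub>J b) * c) \<circ>\<^sub>J e = 0" for e
      by (simp add: sq)
  qed
  have part1: "(Poly_Mapping.single (h + g) (a \<circ>\<^sub>J b) \<circ>\<^sub>J Poly_Mapping.single k c)
      \<circ>\<^sub>J Poly_Mapping.single l d = 0"
    using central_single_jordan_prod_single[OF u central(1)[of a b], of "h + g" k c]
      jordan_prod_diff_left[of 0 "twisted_diff u ((a \<circ>\<^sub>J b) * c) (k + (h + g))"]
    by (auto simp: central_twisted_diff_jordan_prod_single[OF u sc])
  have part2: "(twisted_diff u (a * b) (h + g) \<circ>\<^sub>J Poly_Mapping.single k c)
      \<circ>\<^sub>J Poly_Mapping.single l d = 0"
    using twisted_diff_jordan_prod_single[OF u, of "a * b" "h + g" k c]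
    by (auto simp: central_twisted_diff_jordan_prod_single[OF u] central)
  show "((Poly_Mapping.single g a \<circ>\<^sub>J Poly_Mapping.single h b) \<circ>\<^sub>J Poly_Mapping.single k c)
      \<circ>\<^sub>J Poly_Mapping.single l d = 0"
    using single_jordan_prod_single_cases[OF u, of g a h b]
    by (auto simp: jordan_prod_diff_left part1 part2)
qed

lemma jordan_nilpotent_4_if_abelian:
  assumes comm: "\<forall>g h :: 'g::group_add. g + h = h + g"
    and N: "jordan_nilpotent TYPE('r::ring_1) 4"
  shows "jordan_nilpotent TYPE('g \<Rightarrow>\<^sub>0 'r) 4"
proof (rule jordan_nilpotent_4_if_single)
  have s: "Poly_Mapping.single (g::'g) a \<circ>\<^sub>J Poly_Mapping.single h b
      = Poly_Mapping.single (g + h) (a \<circ>\<^sub>J b)" for g h and a b :: 'r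
    using comm[rule_format, of h g]
    by (simp add: single_jordan_prod_single jordan_prod_def[of a b] single_add)
  show "((Poly_Mapping.single g a \<circ>\<^sub>J Poly_Mapping.single h b) \<circ>\<^sub>J Poly_Mapping.single k c)
      \<circ>\<^sub>J Poly_Mapping.single l d = 0" for g h k l :: 'g and a b c d :: 'r
    using N by (simp add: s jordan_nilpotent_4)
qed

section \<open>The characterisation\<close>

theorem theorem2p3:
  assumes noncomm: "\<not> (\<forall>a b :: 'r::ring_1. a * b = b * a)"
  shows "jordan_nilpotent TYPE('g::group_add \<Rightarrow>\<^sub>0 'r) 4 \<longleftrightarrow>
      (comm_group (group_of_type TYPE('g)) \<and> jordan_nilpotent TYPE('r) 4 \<and> CHAR('r) \<in> {2, 4, 8})
    \<or> (CHAR('r) = 4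
        \<and> (\<forall>a b :: 'r. 2 * (a \<circ>\<^sub>J b) = 0)
        \<and> (\<forall>a b c :: 'r. (a \<circ>\<^sub>J b) \<circ>\<^sub>J c = 0)
        \<and> (\<forall>a b c d :: 'r. (a \<circ>\<^sub>J b) * (c \<circ>\<^sub>J d) = 0)
        \<and> derived_subgroup (group_of_type TYPE('g)) \<cong> integer_mod_group 2)
    \<or> (CHAR('r) = 2
        \<and> (\<forall>a b c :: 'r. (a \<circ>\<^sub>J b) \<circ>\<^sub>J c = 0)
        \<and> (\<forall>a b c d :: 'r. (a \<circ>\<^sub>J b) * (c \<circ>\<^sub>J d) = 0)
        \<and> derived_subgroup (group_of_type TYPE('g)) \<cong> integer_mod_group 2)"
proof (rule iffI, goal_cases)
  case 1
  note N = 1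
  note R = jordan_nilpotent_coefficients[OF N]
  show ?case
  proof (cases "\<forall>g h :: 'g. g + h = h + g")
    case True
    then show ?thesis
      using R CHAR_if_jordan_nilpotent_4[OF R] by (simp add: comm_group_of_type_iff)
  next
    case False
    then obtain g h :: 'g where ne: "g + h \<noteq> h + g" by blast
    from noncomm obtain a b :: 'r where ab: "a * b \<noteq> b * a" by blast
    obtain u :: 'g where u: "commutation_element u"
      using conj_class_le_two_imp_commutation_element
        conj_class_le_two_if_jordan_nilpotent_4[OF N ab] by blast
    have iso: "derived_subgroup (group_of_type TYPE('g)) \<cong> integer_mod_group 2"
      using commutation_element_imp_derived_subgroup_iso_C2[OF u ne] .
    have nil: "(a \<circ>\<^sub>J b) \<circ>\<^sub>J c = 0" for a b c :: 'r
      using jordan_nilpotent_3_if_noncommutative_group[OF N ne] .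
    have sq: "(a \<circ>\<^sub>J b) * (c \<circ>\<^sub>J d) = 0" for a b c d :: 'r
      using jordan_prod_times_jordan_prod[OF N ne] .
    have two: "2 * (a \<circ>\<^sub>J b) = 0" for a b :: 'r
      using nil[of a b 1] by (simp add: jordan_prod_one_right mult_2)
    show ?thesis
      using CHAR_if_jordan_nilpotent_3[OF nil] iso nil sq two by blast
  qed
next
  case 2
  then show ?case
  proof (elim disjE conjE)
    assume "comm_group (group_of_type TYPE('g))" "jordan_nilpotent TYPE('r) 4"
    then show ?thesis
      by (intro jordan_nilpotent_4_if_abelian) (simp_all add: comm_group_of_type_iff)
  qed (use derived_subgroup_iso_C2_imp_commutation_element[where 'g = 'g]
      jordan_nilpotent_4_if_commutation_element[where 'g = 'g and 'r = 'r] in blast)+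
qed

end
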